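(* Let $N\ge1$, let $\omega_0,\dots,\omega_{N-1}>0$ be constant Lagrangian markers, and let $\bar v>0$ with $\bar v\le\min_{i=0,\dots,N-1}\omega_i$. Consider the nonlocal microscopic traffic model described in the context with gaps $y_i(t)=x_{i+1}(t)-x_i(t)$, and let $\bar L_i>0$ be the equilibrium distances, i.e. $v\left(\frac{1}{N\bar L_i},\omega_i\right)=\bar v$, $i=0,\dots,N-1$. Assume that the kernel $w$ is concave on $[0,\eta]$, and that there is a constant $v'_{\max}<0$ with $\max_{i\in\{0,\dots,N-1\}}\partial_\rho v(\rho,\omega_i)\le v'_{\max}$ for all admissible densities $\rho$. Let the initial placement of cars and $\bar v$ be such that there exists an integer in $\{0,\dots,N-1\}$ satisfying $$\sum_{i=J}^{N-1}\max\{y_i(0),\bar L_i\}\le\eta ,$$ and let $J$ be the smallest such integer. Assume in addition that $\omega_i=\omega$ for $i=J,\dots,N-1$ with some $\omega>0$, and that, with $\bar L>0$ given by $v\left(\frac{1}{N\bar L},\omega\right)=\bar v$ (so $\bar L_i=\bar L$ for $i\ge J$), the initial data satisfy either $$y_J(0)\ge\dots\ge y_{N-1}(0)\ge\bar L\qquad\text{or}\qquad y_J(0)\le\dots\le y_{N-1}(0)\le\bar L .$$ Define $$L(t):=\sum_{i=J}^{N-1}y_i(t)\left(\frac{1}{Ny_i(t)}-\frac{1}{N\bar L_i}\right)^2,\qquad \rho_{\min}:=\min_{i=J,\dots,N-1}\min\left\{\frac{1}{Ny_i(0)},\frac{1}{N\bar L_i}\right\}.$$ Then $$L(t)\le L(0)\exp\left(2\,v'_{\max}\,\rho_{\min}\int_0^t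 w\big(x_N(s)-x_J(s)\big)\,ds\right)\qquad\text{for all } t\ge0 .$$
   Context: Kernel. Fix $\eta>0$ and $w\in C^1([0,\eta];[0,\infty))$ with $w'\le 0$ and $\int_0^\eta w(x)\,dx=1$. Set $\tilde w(x)=w(x)$ for $x\in[0,\eta]$ and $\tilde w(x)=0$ otherwise. Velocity. $v(\rho,\omega)$ is twice continuously differentiable in $\rho$ and continuously differentiable in $\omega$. For every $\omega>0$ there is $\rho^{\max}_\omega>0$ with $v(\rho^{\max}_\omega,\omega)=0$; the admissible densities for $\omega$ are $\rho\in[0,\rho^{\max}_\omega]$. On admissible densities: $v(\rho,\omega)\ge 0$, $v(0,\omega)=\omega$, $v(\rho,0)=0$; $\frac{\partial^2}{\partial\rho^2}\big(\rho v(\rho,\omega)\big)<0$ for $\omega>0$; and $\frac{\partial v}{\partial\omega}(\rho,\omega)>0$ for $0\le\rho<\rho^{\max}_\omega$. Microscopic model. There are $N+1$ cars with positions $x_0(t)<x_1(t)<\dots<x_N(t)$, whose initial gaps correspond to admissible densities, i.e. $\frac{1}{Ny_i(0)}\le\rho^{\max}_{\omega_i}$, satisfying for $t>0$ $$\frac{d}{dt}x_i(t)=\sum_{j=0}^{N_\eta-1}\gamma_{i,j}(t)V_{i,j}(t),\quad i=0,\dots,N,$$ where $$V_{i,j}(t)=v\left(\frac{1}{N(x_{i+1+j}(t)-x_{i+j}(t))},\omega_{i+j}\right)\ \text{if } i+j\le N-1,\qquad V_{i,j}(t)=\bar v\ \text{if } i+j>N-1$$ (in particular $\frac{d}{dt}x_N=\bar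 v$), and the weights are $$\gamma_{i,j}(t)=\begin{cases}\int_{x_{i+j}(t)}^{x_{i+j+1}(t)}\tilde w(y-x_i(t))\,dy,& i+j\le N-1,\\ \int_{\min\{x_N(t),x_i(t)+\eta\}}^{x_i(t)+\eta}\tilde w(y-x_i(t))\,dy,& i+j=N,\\ 0,& i+j>N.\end{cases}$$ The integer $N_\eta$ is large enough that $x_{i+N_\eta}(t)-x_i(t)\ge\eta$ whenever $i+N_\eta\le N$ (so $\gamma_{i,j}=0$ for $j\ge N_\eta$ and $\sum_{j=0}^{N_\eta-1}\gamma_{i,j}(t)=1$). *)

theory Defs
  imports "HOL-Analysis.Analysis"
begin

text \<open>
  Derivatives are taken relative to the domain of the function (one-sided at end points).  All
  domains below are nondegenerate intervals, on which such a derivative is unique.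
\<close>

definition deriv_within :: "real set \<Rightarrow> (real \<Rightarrow> real) \<Rightarrow> real \<Rightarrow> real" where
  "deriv_within S f x = vector_derivative f (at x within S)"

definition C1_on :: "real set \<Rightarrow> (real \<Rightarrow> real) \<Rightarrow> bool" where
  "C1_on S f \<longleftrightarrow> f differentiable_on S \<and> continuous_on S (deriv_within S f)"

definition C2_on :: "real set \<Rightarrow> (real \<Rightarrow> real) \<Rightarrow> bool" where
  "C2_on S f \<longleftrightarrow> C1_on S f \<and> C1_on S (deriv_within S f)"

locale nonlocal_kernel =
  fixes eta :: real and w :: "real \<Rightarrow> real"
  assumes eta_pos: "eta > 0"
    and w_C1: "C1_on {0..eta} w"
    and w_nonneg: "\<And>z. z \<in> {0..eta} \<Longrightarrow> w z \<ge> 0"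
    and w_deriv_nonpos: "\<And>z. z \<in> {0..eta} \<Longrightarrow> deriv_within {0..eta} w z \<le> 0"
    and w_integral: "integral {0..eta} w = 1"

definition w_tilde :: "real \<Rightarrow> (real \<Rightarrow> real) \<Rightarrow> real \<Rightarrow> real" where
  "w_tilde eta w z = (if z \<in> {0..eta} then w z else 0)"

text \<open>
  The velocity \<open>v \<rho> \<omega>\<close> is regular on the domain \<open>\<rho> \<ge> 0\<close>, \<open>\<omega> \<ge> 0\<close>, in each variable separately;
  the sign conditions are only required on the admissible densities.  At \<open>\<omega> = 0\<close> no maximal
  density is given, and \<open>v \<rho> 0 = 0\<close> is required for each \<open>\<rho>\<close> admissible for some \<open>\<omega> > 0\<close>.
\<close>

locale velocity_law =
  fixes v :: "real \<Rightarrow> real \<Rightarrow> real" and rho_max :: "real \<Rightarrow> real"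
  assumes v_C2_rho: "\<And>om. om \<ge> 0 \<Longrightarrow> C2_on {0..} (\<lambda>r. v r om)"
    and v_C1_omega: "\<And>r. r \<ge> 0 \<Longrightarrow> C1_on {0..} (\<lambda>om. v r om)"
    and rho_max_pos: "\<And>om. om > 0 \<Longrightarrow> rho_max om > 0"
    and v_rho_max: "\<And>om. om > 0 \<Longrightarrow> v (rho_max om) om = 0"
    and v_nonneg: "\<And>r om. om > 0 \<Longrightarrow> r \<in> {0..rho_max om} \<Longrightarrow> v r om \<ge> 0"
    and v_empty: "\<And>om. om > 0 \<Longrightarrow> v 0 om = om"
    and v_omega_zero: "\<And>r om. om > 0 \<Longrightarrow> r \<in> {0..rho_max om} \<Longrightarrow> v r 0 = 0"
    and flux_concave: "\<And>r om. om > 0 \<Longrightarrow> r \<in> {0..rho_max om} \<Longrightarrow>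
           deriv_within {0..} (deriv_within {0..} (\<lambda>s. s * v s om)) r < 0"
    and v_incr_omega: "\<And>r om. om > 0 \<Longrightarrow> r \<in> {0..<rho_max om} \<Longrightarrow>
           deriv_within {0..} (\<lambda>z. v r z) om > 0"

text \<open>Position of car \<open>i\<close> at time \<open>t\<close> is \<open>x i t\<close>; the gaps have indices \<open>i < N\<close>.\<close>

definition gap :: "(nat \<Rightarrow> real \<Rightarrow> real) \<Rightarrow> nat \<Rightarrow> real \<Rightarrow> real" where
  "gap x i t = x (i + 1) t - x i t"

definition V_micro ::
  "nat \<Rightarrow> (real \<Rightarrow> real \<Rightarrow> real) \<Rightarrow> (nat \<Rightarrow> real) \<Rightarrow> real \<Rightarrow> (nat \<Rightarrow> real \<Rightarrow> real) \<Rightarrow>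
   nat \<Rightarrow> nat \<Rightarrow> real \<Rightarrow> real" where
  "V_micro N v omega vbar x i j t =
     (if i + j < N then v (1 / (real N * (x (i + 1 + j) t - x (i + j) t))) (omega (i + j))
      else vbar)"

definition gamma_micro ::
  "nat \<Rightarrow> real \<Rightarrow> (real \<Rightarrow> real) \<Rightarrow> (nat \<Rightarrow> real \<Rightarrow> real) \<Rightarrow> nat \<Rightarrow> nat \<Rightarrow> real \<Rightarrow> real" where
  "gamma_micro N eta w x i j t =
     (if i + j < N then
        integral {x (i + j) t .. x (i + j + 1) t} (\<lambda>y. w_tilde eta w (y - x i t))
      else if i + j = N then
        integral {min (x N t) (x i t + eta) .. x i t + eta} (\<lambda>y. w_tilde eta w (y - x i t))
      else 0)"

text \<open>
  The equations hold for \<open>t > 0\<close>; continuity on \<open>t \<ge> 0\<close> ties the solution to its initial data.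
\<close>

locale micro_model =
  nonlocal_kernel eta w + velocity_law v rho_max
  for eta :: real and w :: "real \<Rightarrow> real"
    and v :: "real \<Rightarrow> real \<Rightarrow> real" and rho_max :: "real \<Rightarrow> real" +
  fixes N N_eta :: nat and omega :: "nat \<Rightarrow> real" and vbar :: real
    and x :: "nat \<Rightarrow> real \<Rightarrow> real"
  assumes x_continuous: "\<And>i. i \<le> N \<Longrightarrow> continuous_on {0..} (x i)"
    and x_ordered: "\<And>i t. i < N \<Longrightarrow> t \<ge> 0 \<Longrightarrow> x i t < x (i + 1) t"
    and initial_admissible: "\<And>i. i < N \<Longrightarrow> 1 / (real N * gap x i 0) \<le> rho_max (omega i)"
    and x_ode: "\<And>i t. i \<le> N \<Longrightarrow> t > 0 \<Longrightarrow>
           (x i has_real_derivative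
             (\<Sum>j<N_eta. gamma_micro N eta w x i j t * V_micro N v omega vbar x i j t)) (at t)"
    and N_eta_large: "\<And>i t. i + N_eta \<le> N \<Longrightarrow> t \<ge> 0 \<Longrightarrow> x (i + N_eta) t - x i t \<ge> eta"

text \<open>
  The density of an equilibrium distance has to be admissible: outside the admissible range
  nothing is known about the monotonicity of \<open>v\<close> in the density.
\<close>

definition equilibrium_gap ::
  "nat \<Rightarrow> (real \<Rightarrow> real \<Rightarrow> real) \<Rightarrow> (real \<Rightarrow> real) \<Rightarrow> real \<Rightarrow> real \<Rightarrow> real \<Rightarrow> bool" where
  "equilibrium_gap N v rho_max vbar om L \<longleftrightarrow>
     L > 0 \<and> 1 / (real N * L) \<le> rho_max om \<and> v (1 / (real N * L)) om = vbar"

definition lyapunov ::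
  "nat \<Rightarrow> nat \<Rightarrow> (nat \<Rightarrow> real \<Rightarrow> real) \<Rightarrow> (nat \<Rightarrow> real) \<Rightarrow> real \<Rightarrow> real" where
  "lyapunov N J x L t =
     (\<Sum>i=J..<N. gap x i t * (1 / (real N * gap x i t) - 1 / (real N * L i))\<^sup>2)"

definition rho_min :: "nat \<Rightarrow> nat \<Rightarrow> (nat \<Rightarrow> real \<Rightarrow> real) \<Rightarrow> (nat \<Rightarrow> real) \<Rightarrow> real" where
  "rho_min N J x L =
     (MIN i\<in>{J..<N}. min (1 / (real N * gap x i 0)) (1 / (real N * L i)))"

end

theory Submission
  imports Defs
begin

text \<open>
  With \<open>W\<close> the primitive of the kernel and \<open>u k\<close> the excess of the speed of car \<open>k\<close> over
  \<open>vbar\<close>, summation by parts gives \<open>x i' = vbar + (\<Sum>k=i..<N. a i k * u k)\<close> with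
  \<open>a i k = W (x (k+1) - x i) - W (x k - x i)\<close>, and \<open>a i k\<close> increases with \<open>i\<close> because \<open>W\<close> is
  concave.  Hence maximum principles, car by car from the leader backwards, keep the densities
  admissible and the gaps on one side of \<open>Lbar\<close>; so the platoon stays within the horizon \<open>eta\<close>.
  There the concavity of \<open>w\<close> preserves the ordering of the gaps, and with ordered gaps
  each gap moves towards \<open>Lbar\<close> at a rate at least \<open>\<bar>u i\<bar> * gap i * w (x N - x J)\<close>.  The
  mean value theorem for \<open>v\<close> then closes a Gronwall estimate for the Lyapunov function.  The sign
  \<open>sg\<close> treats the two kinds of initial data at once: \<open>1\<close> for gaps above \<open>Lbar\<close>,
  \<open>-1\<close> for gaps below.
\<close>

section \<open>One-sided derivatives and a barrier principle\<close>

lemma deriv_within_has_derivative: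
  assumes "f differentiable_on S" "z \<in> S"
  shows "(f has_real_derivative deriv_within S f z) (at z within S)"
proof -
  have "f differentiable (at z within S)"
    using assms by (simp add: differentiable_on_def)
  then show ?thesis
    by (simp add: deriv_within_def has_real_derivative_iff_has_vector_derivative
        vector_derivative_works)
qed

text \<open>A positive value would force \<open>f\<close> to climb from 0 to a level below
  \<open>\<delta>\<close>, which Gronwall's argument excludes. Since \<open>growth\<close> is asked
  only in the strip between 0 and \<open>\<delta>\<close>, information near the boundary suffices to
  verify it.\<close>

lemma barrier_le_zero:
  fixes f f' :: "real \<Rightarrow> real"
  assumes cont: "continuous_on {0..T} f" and init: "f 0 \<le> 0" and delta: "\<delta> > 0"
    and deriv: "\<And>t. 0 < t \<Longrightarrow> t \<le> T \<Longrightarrow> (f has_real_derivative f' t) (at t)"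
    and growth: "\<And>t. 0 < t \<Longrightarrow> t \<le> T \<Longrightarrow> 0 < f t \<Longrightarrow> f t < \<delta> \<Longrightarrow> f' t \<le> K * f t"
    and t: "0 \<le> t" "t \<le> T"
  shows "f t \<le> 0"
proof (rule ccontr)
  assume "\<not> f t \<le> 0"
  then have pos: "f t > 0" by simp
  \<comment> \<open>A level inside the strip that \<open>f\<close> reaches by time
    \<open>t\<close>.\<close>
  define h where "h = min (f t) (\<delta> / 2)"
  have h: "0 < h" "h \<le> f t" "h < \<delta>" using pos delta by (auto simp: h_def)
  have ct: "continuous_on {a..b} f" if "0 \<le> a" "b \<le> t" for a b
    using cont that t by (auto intro: continuous_on_subset)
  \<comment> \<open>The first time at level \<open>h\<close>; before it \<open>f\<close> stays below
    \<open>h\<close>.\<close>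
  obtain b where b: "0 \<le> b" "b \<le> t" "f b = h" and b_min: "\<And>s. 0 \<le> s \<Longrightarrow> s < b \<Longrightarrow> f s \<noteq> h"
  proof -
    define B where "B = {s\<in>{0..t}. f s = h}"
    have "\<exists>s. 0 \<le> s \<and> s \<le> t \<and> f s = h"
      using IVT'[of f 0 h t] init h t ct by auto
    then have ne: "B \<noteq> {}" by (auto simp: B_def)
    have "closed B"
      unfolding B_def using continuous_closed_preimage_constant[OF ct[of 0 t]] by simp
    moreover have bdd: "bdd_below B" by (auto simp: B_def intro!: bdd_belowI[of _ 0])
    ultimately have "Inf B \<in> B" using ne by (simp add: closed_contains_Inf)
    then show thesis
      using that[of "Inf B"] cInf_lower[OF _ bdd] by (force simp: B_def)
  qed
  have below: "f s < h" if "0 \<le> s" "s < b" for s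
  proof (rule ccontr)
    assume "\<not> f s < h"
    moreover have "continuous_on {0..s} f" by (rule ct) (use that b in auto)
    ultimately obtain r where "0 \<le> r" "r \<le> s" "f r = h"
      using IVT'[of f 0 h s] init h \<open>0 \<le> s\<close> by auto
    then show False using b_min[of r] that by auto
  qed
  \<comment> \<open>The last time before \<open>b\<close> with \<open>f\<close> nonpositive, so that
    \<open>growth\<close> applies everywhere between \<open>a\<close> and \<open>b\<close>.\<close>
  obtain a where a: "0 \<le> a" "a < b" "f a \<le> 0" and a_max: "\<And>s. a < s \<Longrightarrow> s \<le> b \<Longrightarrow> 0 < f s"
  proof -
    define A where "A = {s\<in>{0..b}. f s \<in> {..0}}"
    have ne: "A \<noteq> {}" using init b by (auto simp: A_def)
    have "closed A"
      unfolding A_def using continuous_closed_preimage[OF ct[of 0 b], of "{..0}"] b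
      by (simp add: vimage_def Int_def)
    moreover have bdd: "bdd_above A" by (auto simp: A_def intro!: bdd_aboveI[of _ b])
    ultimately have "Sup A \<in> A" using ne by (simp add: closed_contains_Sup)
    then have S: "0 \<le> Sup A" "Sup A \<le> b" "f (Sup A) \<le> 0" by (auto simp: A_def)
    moreover have "Sup A \<noteq> b" using S h b by auto
    moreover have "0 < f s" if "Sup A < s" "s \<le> b" for s
    proof (rule ccontr)
      assume "\<not> 0 < f s"
      then have "s \<in> A" using that S by (auto simp: A_def)
      then show False using cSup_upper[OF _ bdd] that by fastforce
    qed
    ultimately show thesis using that[of "Sup A"] by auto
  qed
  \<comment> \<open>The integrating factor turns \<open>growth\<close> into monotonicity of
    \<open>g\<close> on \<open>{a..b}\<close>.\<close>
  define g where "g s = f s * exp (- K * s)" for s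
  have "g a \<ge> g b"
  proof (rule DERIV_nonpos_imp_decreasing_open[where f = g])
    show "a \<le> b" using a by simp
    show "continuous_on {a..b} g"
      unfolding g_def using ct[of a b] a b by (intro continuous_intros) auto
    fix s assume s: "a < s" "s < b"
    then have "(f has_real_derivative f' s) (at s)" using deriv a b t by auto
    then have "(g has_real_derivative (f' s - K * f s) * exp (- K * s)) (at s)"
      unfolding g_def by (auto intro!: derivative_eq_intros simp: algebra_simps)
    moreover have "f' s \<le> K * f s"
      using growth[of s] a_max[of s] below[of s] s a b t h by auto
    ultimately show "\<exists>y. (g has_real_derivative y) (at s) \<and> y \<le> 0"
      by (intro exI[of _ "(f' s - K * f s) * exp (- K * s)"]) (auto simp: mult_le_0_iff)
  qed
  moreover have "g a \<le> 0" using a by (simp add: g_def mult_le_0_iff)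
  moreover have "g b > 0" using h b by (simp add: g_def)
  ultimately show False by simp
qed

section \<open>The kernel and its primitive\<close>

context nonlocal_kernel
begin

lemma w_has_derivative:
  assumes "z \<in> {0..eta}"
  shows "(w has_real_derivative deriv_within {0..eta} w z) (at z within {0..eta})"
  using assms w_C1 by (intro deriv_within_has_derivative) (auto simp: C1_on_def)

lemma w_continuous: "continuous_on {0..eta} w"
  using w_has_derivative DERIV_continuous_on by blast

lemma w_decreasing:
  assumes "0 \<le> a" "a \<le> b" "b \<le> eta"
  shows "w b \<le> w a"
proof (rule DERIV_nonpos_imp_decreasing_open[where f = w])
  show "continuous_on {a..b} w"
    using w_continuous assms by (auto intro: continuous_on_subset)
  fix z assume z: "a < z" "z < b"
  then have "at z within {0..eta} = at z"
    using assms by (intro at_within_interior) auto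
  then show "\<exists>y. (w has_real_derivative y) (at z) \<and> y \<le> 0"
    using w_has_derivative[of z] w_deriv_nonpos[of z] z assms by auto
qed (fact assms)

lemma w_lipschitz:
  obtains K where "K \<ge> 0" "\<And>a b. a \<in> {0..eta} \<Longrightarrow> b \<in> {0..eta} \<Longrightarrow> \<bar>w a - w b\<bar> \<le> K * \<bar>a - b\<bar>"
proof -
  have "continuous_on {0..eta} (deriv_within {0..eta} w)" using w_C1 by (simp add: C1_on_def)
  then have "bounded (deriv_within {0..eta} w ` {0..eta})"
    by (intro compact_imp_bounded compact_continuous_image) auto
  then obtain K where K: "K > 0" "\<And>z. z \<in> {0..eta} \<Longrightarrow> \<bar>deriv_within {0..eta} w z\<bar> \<le> K"
    unfolding bounded_pos by (auto simp: real_norm_def)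
  have "\<bar>w a - w b\<bar> \<le> K * \<bar>a - b\<bar>" if "a \<in> {0..eta}" "b \<in> {0..eta}" for a b
    using field_differentiable_bound[of "{0..eta}" w "deriv_within {0..eta} w" K a b]
      w_has_derivative K that by (auto simp: real_norm_def)
  with K(1) show thesis by (intro that[of K]) auto
qed

lemma w_tilde_nonneg: "w_tilde eta w z \<ge> 0"
  using w_nonneg by (simp add: w_tilde_def)

lemma w_tilde_decreasing: "0 \<le> a \<Longrightarrow> a \<le> b \<Longrightarrow> w_tilde eta w b \<le> w_tilde eta w a"
  using w_nonneg w_decreasing by (auto simp: w_tilde_def)

lemma w_tilde_integrable: "w_tilde eta w integrable_on {a..b}"
proof -
  have "w integrable_on {0..eta}"
    by (rule integrable_continuous_real[OF w_continuous])
  then have "w_tilde eta w integrable_on UNIV"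
    unfolding w_tilde_def by (subst integrable_restrict_UNIV)
  then show ?thesis by (rule integrable_on_subinterval) auto
qed

text \<open>Taking \<open>w_tilde\<close> instead of \<open>w\<close> allows every nonnegative
  distance as argument; past \<open>eta\<close> the value stays 1, so cars beyond the horizon get
  weight zero automatically.\<close>

definition W :: "real \<Rightarrow> real" where
  "W z = integral {0..z} (w_tilde eta w)"

lemma W_has_integral:
  assumes "0 \<le> p" "p \<le> q"
  shows "(w_tilde eta w has_integral (W q - W p)) {p..q}"
proof -
  have "W p + integral {p..q} (w_tilde eta w) = W q"
    unfolding W_def by (rule Henstock_Kurzweil_Integration.integral_combine)
      (use assms w_tilde_integrable in auto)
  then show ?thesis
    using integrable_integral[OF w_tilde_integrable[of p q]] by (metis add_diff_cancel_left')
qed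

lemma W_shift_has_integral:
  assumes "c \<le> p" "p \<le> q"
  shows "((\<lambda>z. w_tilde eta w (z - c)) has_integral (W (q - c) - W (p - c))) {p..q}"
  using has_integral_affinity'[of "w_tilde eta w" "W (q - c) - W (p - c)" "p - c" "q - c" 1 "-c"]
    W_has_integral[of "p - c" "q - c"] assms by simp

lemma W_0 [simp]: "W 0 = 0"
  by (simp add: W_def)

lemma W_mono: "0 \<le> p \<Longrightarrow> p \<le> q \<Longrightarrow> W p \<le> W q"
  using has_integral_nonneg[OF W_has_integral] w_tilde_nonneg by fastforce

lemma W_nonneg: "0 \<le> p \<Longrightarrow> 0 \<le> W p"
  using W_mono[of 0 p] by simp

lemma W_eta: "W eta = 1"
proof -
  have "W eta = integral {0..eta} w"
    unfolding W_def by (rule integral_cong) (simp add: w_tilde_def)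
  then show ?thesis using w_integral by simp
qed

lemma W_ge_eta:
  assumes "eta \<le> q"
  shows "W q = 1"
proof -
  \<comment> \<open>\<open>w eta\<close> may be positive, so the integrand vanishes only off the
    point \<open>eta\<close>.\<close>
  have "((\<lambda>z. 0) has_integral (W q - W eta)) {eta..q}"
    by (rule has_integral_spike[of "{eta}", OF _ _ W_has_integral])
      (use assms eta_pos in \<open>auto simp: w_tilde_def\<close>)
  then show ?thesis using has_integral_unique[OF has_integral_0] W_eta by fastforce
qed

text \<open>The kernel is smallest at the right end point. This bound brings the kernel value at the
  platoon length into the decay rate.\<close>

lemma W_diff_ge:
  assumes "0 \<le> p" "p \<le> q" "q \<le> eta"
  shows "(q - p) * w q \<le> W q - W p"
  using has_integral_le[OF has_integral_const_real W_has_integral, of p q "w q"]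
    w_tilde_decreasing[of _ q] assms by (force simp: w_tilde_def)

lemma W_diff_le:
  assumes "0 \<le> p" "p \<le> q"
  shows "W q - W p \<le> (q - p) * w 0"
  using has_integral_le[OF W_has_integral has_integral_const_real, of p q "w 0"]
    w_tilde_decreasing[of 0] assms eta_pos by (force simp: w_tilde_def)

text \<open>\<open>w_tilde\<close> is nonincreasing on the nonnegative reals, its drop to 0 past
  \<open>eta\<close> included, so shifting the window to the right lowers the integral.\<close>

lemma W_concave:
  assumes "0 \<le> p" "p \<le> q" "0 \<le> h"
  shows "W (q + h) - W (p + h) \<le> W q - W p"
proof (rule has_integral_le)
  show "((\<lambda>z. w_tilde eta w (z + h)) has_integral (W (q + h) - W (p + h))) {p..q}"
    using W_shift_has_integral[of "-h" p q] assms by simp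
qed (use assms W_has_integral w_tilde_decreasing in auto)

text \<open>
  Where \<open>\<alpha> = \<beta>\<close> the concavity of \<open>w\<close> gives the sign of the second difference; the
  mismatch \<open>\<alpha> > \<beta>\<close> costs its size times the Lipschitz constant of \<open>w\<close>.
\<close>

lemma W_second_difference:
  assumes conc: "concave_on {0..eta} w"
    and K: "K \<ge> 0" "\<And>a b. a \<in> {0..eta} \<Longrightarrow> b \<in> {0..eta} \<Longrightarrow> \<bar>w a - w b\<bar> \<le> K * \<bar>a - b\<bar>"
    and pq: "0 \<le> \<alpha>" "0 \<le> \<beta>" "\<alpha> \<le> p" "p \<le> q" "q + \<beta> \<le> eta"
  shows "2 * (W q - W p) - (W (q - \<alpha>) - W (p - \<alpha>)) - (W (q + \<beta>) - W (p + \<beta>))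
    \<ge> - (K * max 0 (\<alpha> - \<beta>) * (q - p))"
proof -
  let ?m = "max 0 (\<alpha> - \<beta>)"
  have second: "((\<lambda>z. 2 * w_tilde eta w z - w_tilde eta w (z - \<alpha>) - w_tilde eta w (z + \<beta>)) has_integral
    2 * (W q - W p) - (W (q - \<alpha>) - W (p - \<alpha>)) - (W (q + \<beta>) - W (p + \<beta>))) {p..q}"
    using W_shift_has_integral[of "-\<beta>" p q] W_shift_has_integral[of \<alpha> p q] pq
    by (intro has_integral_diff has_integral_mult_right W_has_integral) auto
  have const: "((\<lambda>z. - (K * ?m)) has_integral (q - p) * - (K * ?m)) {p..q}"
    using has_integral_const_real[of "- (K * ?m)" p q] pq by simp
  have "- (K * ?m) \<le> 2 * w_tilde eta w z - w_tilde eta w (z - \<alpha>) - w_tilde eta w (z + \<beta>)"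
    if z: "z \<in> {p..q}" for z
  proof -
    \<comment> \<open>Midpoint concavity needs equal shifts, so the smaller one is used. Extending
      the right shift to \<beta> only lowers \<open>w\<close>; extending the left shift to \<alpha>
      is paid for by the Lipschitz bound.\<close>
    define \<mu> where "\<mu> = min \<alpha> \<beta>"
    have in_dom: "z - \<alpha> \<in> {0..eta}" "z - \<mu> \<in> {0..eta}" "z + \<mu> \<in> {0..eta}" "z + \<beta> \<in> {0..eta}"
        "z \<in> {0..eta}"
      using z pq by (auto simp: \<mu>_def min_def)
    have "w (z - \<mu>) / 2 + w (z + \<mu>) / 2 \<le> w ((1 - 1/2) *\<^sub>R (z - \<mu>) + (1/2) *\<^sub>R (z + \<mu>))"
      using concave_onD[OF conc, of "1/2" "z - \<mu>" "z + \<mu>"] in_dom by simp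
    also have "(1 - 1/2) *\<^sub>R (z - \<mu>) + (1/2) *\<^sub>R (z + \<mu>) = z"
      by (simp add: field_simps)
    finally have "w (z - \<mu>) + w (z + \<mu>) \<le> 2 * w z" by simp
    moreover have "w (z + \<beta>) \<le> w (z + \<mu>)"
      using w_decreasing[of "z + \<mu>" "z + \<beta>"] in_dom by (auto simp: \<mu>_def)
    moreover have "w (z - \<alpha>) - w (z - \<mu>) \<le> K * ?m"
    proof -
      have "\<bar>(z - \<alpha>) - (z - \<mu>)\<bar> = ?m" by (auto simp: \<mu>_def)
      then show ?thesis using K(2)[OF in_dom(1,2)] by simp
    qed
    ultimately show ?thesis using in_dom by (auto simp: w_tilde_def)
  qed
  then show ?thesis
    using has_integral_le[OF const second] by (simp add: algebra_simps)
qed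

end

section \<open>The velocity as a function of the density\<close>

context velocity_law
begin

lemma v_has_derivative:
  assumes "om > 0" "0 \<le> r"
  shows "((\<lambda>s. v s om) has_real_derivative deriv_within {0..} (\<lambda>s. v s om) r) (at r within {0..})"
  using v_C2_rho[of om] assms
  by (intro deriv_within_has_derivative) (auto simp: C2_on_def C1_on_def)

text \<open>After subtracting the line \<open>slope * s\<close>, monotonicity follows from the
  interior points, where the derivative within \<open>{0..}\<close> is the two-sided one.\<close>

lemma v_slope:
  assumes om: "om > 0"
    and slope: "\<And>r. r \<in> {0..rho_max om} \<Longrightarrow> deriv_within {0..} (\<lambda>s. v s om) r \<le> slope"
    and r: "0 \<le> r" "r \<le> r'" "r' \<le> rho_max om"
  shows "v r' om - v r om \<le> slope * (r' - r)"
proof -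
  let ?f = "\<lambda>s. v s om - slope * s"
  have "?f r' \<le> ?f r"
  proof (rule DERIV_nonpos_imp_decreasing_open[where f = ?f])
    have "continuous_on {0..} (\<lambda>s. v s om)"
      using v_has_derivative om by (blast intro: DERIV_continuous_on atLeast_iff[THEN iffD1])
    then show "continuous_on {r..r'} ?f"
      using r by (intro continuous_intros) (auto intro: continuous_on_subset)
    fix s assume s: "r < s" "s < r'"
    then have "at s within {0..} = at s"
      using r by (intro at_within_interior) (auto simp: interior_real_atLeast)
    then have "(?f has_real_derivative deriv_within {0..} (\<lambda>s. v s om) s - slope) (at s)"
      using v_has_derivative[OF om, of s] s r by (auto intro!: derivative_eq_intros)
    then show "\<exists>y. (?f has_real_derivative y) (at s) \<and> y \<le> 0"
      using slope[of s] s r by fastforce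
  qed (fact r)
  then show ?thesis by (simp add: algebra_simps)
qed

end

section \<open>The platoon and its equations of motion\<close>

text \<open>The speed of a car depends only on gaps from its own forward, so the cars from
  \<open>J\<close> on form a closed system with one marker and one equilibrium gap. The maximum in
  \<open>length_init\<close> bounds the platoon length for both values of \<open>sg\<close>.\<close>

locale platoon = micro_model eta w v rho_max N N_eta omega vbar x
  for eta :: real and w :: "real \<Rightarrow> real" and v :: "real \<Rightarrow> real \<Rightarrow> real"
    and rho_max :: "real \<Rightarrow> real" and N N_eta :: nat and omega :: "nat \<Rightarrow> real"
    and vbar :: real and x :: "nat \<Rightarrow> real \<Rightarrow> real" +
  fixes J :: nat and om Lbar slope sg :: real
  assumes J_less: "J < N" and om_pos: "om > 0" and vbar_pos: "vbar > 0"
    and w_concave: "concave_on {0..eta} w"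
    and marker: "\<And>i. i \<in> {J..<N} \<Longrightarrow> omega i = om"
    and equilibrium: "equilibrium_gap N v rho_max vbar om Lbar"
    and slope_neg: "slope < 0"
    and slope: "\<And>r. r \<in> {0..rho_max om} \<Longrightarrow> deriv_within {0..} (\<lambda>s. v s om) r \<le> slope"
    and sg: "sg = 1 \<or> sg = -1"
    and side_init: "\<And>i. i \<in> {J..<N} \<Longrightarrow> 0 \<le> sg * (gap x i 0 - Lbar)"
    and order_init: "\<And>i. J \<le> i \<Longrightarrow> Suc i < N \<Longrightarrow> sg * (gap x (Suc i) 0 - gap x i 0) \<le> 0"
    and length_init: "(\<Sum>i=J..<N. max (gap x i 0) Lbar) \<le> eta"
begin

definition rho :: "nat \<Rightarrow> real \<Rightarrow> real" where
  "rho i t = 1 / (real N * gap x i t)"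

definition rho_bar :: real where
  "rho_bar = 1 / (real N * Lbar)"

definition u :: "nat \<Rightarrow> real \<Rightarrow> real" where
  "u i t = v (rho i t) om - vbar"

definition a :: "nat \<Rightarrow> nat \<Rightarrow> real \<Rightarrow> real" where
  "a i k t = W (x (Suc k) t - x i t) - W (x k t - x i t)"

text \<open>The term of car \<open>i\<close> itself is set apart because its weight is nonpositive,
  while the increments of \<open>a\<close> are nonnegative by \<open>a_increasing\<close>.\<close>

definition gap_rate :: "nat \<Rightarrow> real \<Rightarrow> real" where
  "gap_rate i t = (\<Sum>k=Suc i..<N. (a (Suc i) k t - a i k t) * u k t) - W (gap x i t) * u i t"

lemma N_pos: "real N > 0"
  using J_less by simp

lemma gap_pos: "i < N \<Longrightarrow> 0 \<le> t \<Longrightarrow> 0 < gap x i t"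
  using x_ordered[of i t] by (simp add: gap_def)

lemma x_mono: "i \<le> k \<Longrightarrow> k \<le> N \<Longrightarrow> 0 \<le> t \<Longrightarrow> x i t \<le> x k t"
proof (induction k rule: dec_induct)
  case (step k)
  then show ?case using x_ordered[of k t] by simp
qed simp

lemma length_eq_sum_gaps: "i \<le> k \<Longrightarrow> (\<Sum>j=i..<k. gap x j t) = x k t - x i t"
  using sum_Suc_diff'[of i k "\<lambda>j. x j t"] by (simp add: gap_def)

lemma sum_a: "m \<le> N \<Longrightarrow> (\<Sum>k=m..<N. a i k t) = W (x N t - x i t) - W (x m t - x i t)"
  using sum_Suc_diff'[of m N "\<lambda>k. W (x k t - x i t)"] by (simp add: a_def)

lemma gamma_inner:
  assumes "i + j < N" "0 \<le> t"
  shows "gamma_micro N eta w x i j t = a i (i + j) t"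
  using W_shift_has_integral[of "x i t" "x (i + j) t" "x (Suc (i + j)) t"]
    x_mono[of i "i + j" t] x_mono[of "i + j" "Suc (i + j)" t] assms
  by (simp add: gamma_micro_def a_def integral_unique)

lemma gamma_last:
  assumes "i + j = N" "0 \<le> t"
  shows "gamma_micro N eta w x i j t = 1 - W (x N t - x i t)"
proof -
  have le: "x i t \<le> x N t" using x_mono[of i N t] assms by simp
  have "gamma_micro N eta w x i j t = W eta - W (min (x N t) (x i t + eta) - x i t)"
    using W_shift_has_integral[of "x i t" "min (x N t) (x i t + eta)" "x i t + eta"]
      le eta_pos assms by (simp add: gamma_micro_def integral_unique)
  also have "W (min (x N t) (x i t + eta) - x i t) = W (x N t - x i t)"
    using W_eta W_ge_eta[of "x N t - x i t"] by (cases "x N t \<le> x i t + eta") auto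
  finally show ?thesis by (simp add: W_eta)
qed

text \<open>From car \<open>i + N_eta\<close> on \<open>W\<close> has reached its final value 1, so
  no increment and no remainder is left.\<close>

lemma gamma_beyond:
  assumes "N_eta \<le> j" "0 \<le> t"
  shows "gamma_micro N eta w x i j t = 0"
proof -
  have far: "W (x k t - x i t) = 1" if "i + N_eta \<le> k" "k \<le> N" for k
    using that N_eta_large[of i t] x_mono[of "i + N_eta" k t] assms by (intro W_ge_eta) auto
  consider "i + j < N" | "i + j = N" | "N < i + j" by linarith
  then show ?thesis
  proof cases
    case 1
    then show ?thesis
      using gamma_inner[OF 1] far[of "i + j"] far[of "Suc (i + j)"] assms by (simp add: a_def)
  next
    case 2
    then show ?thesis using gamma_last[OF 2] far[of N] assms by simp
  qed (simp add: gamma_micro_def)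
qed

text \<open>The weights sum to 1, so \<open>vbar\<close> splits off and only the excess speeds
  \<open>u\<close> remain.\<close>

lemma velocity_sum:
  assumes i: "J \<le> i" "i \<le> N" and t: "0 \<le> t"
  shows "(\<Sum>j<N_eta. gamma_micro N eta w x i j t * V_micro N v omega vbar x i j t) =
    vbar + (\<Sum>k=i..<N. a i k t * u k t)"
proof -
  let ?g = "\<lambda>j. gamma_micro N eta w x i j t * V_micro N v omega vbar x i j t"
  define n where "n = N - i"
  have n: "i + n = N" using i by (simp add: n_def)
  \<comment> \<open>Either of \<open>N_eta\<close> and \<open>Suc n\<close> may be larger: padding
    to the maximum adds zero weights, and cutting to \<open>Suc n\<close> removes the zero weights
    with \<open>i + j > N\<close>.\<close>
  have "sum ?g {..<N_eta} = sum ?g {..<max N_eta (Suc n)}"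
    using gamma_beyond t by (intro sum.mono_neutral_left) auto
  also have "\<dots> = sum ?g {..<Suc n}"
    using n by (intro sum.mono_neutral_right) (auto simp: gamma_micro_def)
  also have "\<dots> = (\<Sum>j<n. ?g j) + (1 - W (x N t - x i t)) * vbar"
    using gamma_last[OF n t] n by (simp add: V_micro_def)
  also have "(\<Sum>j<n. ?g j) = (\<Sum>j=0..<n. a i (j + i) t * (u (j + i) t + vbar))"
  proof (rule sum.cong)
    fix j assume "j \<in> {0..<n}"
    then have j: "i + j < N" using n by simp
    then show "?g j = a i (j + i) t * (u (j + i) t + vbar)"
      using gamma_inner[OF j t] marker[of "i + j"] i
      by (simp add: V_micro_def u_def rho_def gap_def add_ac)
  qed auto
  also have "\<dots> = (\<Sum>k=i..<N. a i k t * (u k t + vbar))"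
    using sum.shift_bounds_nat_ivl[of "\<lambda>k. a i k t * (u k t + vbar)" 0 i n] n
    by (simp add: add.commute)
  also have "\<dots> = (\<Sum>k=i..<N. a i k t * u k t) + W (x N t - x i t) * vbar"
    using sum_a[of i i t] i
    by (simp add: distrib_left sum.distrib flip: sum_distrib_right)
  finally show ?thesis by (simp add: algebra_simps)
qed

lemma x_has_derivative:
  assumes "J \<le> i" "i \<le> N" "0 < t"
  shows "(x i has_real_derivative vbar + (\<Sum>k=i..<N. a i k t * u k t)) (at t)"
  using x_ode[of i t] velocity_sum[of i t] assms by simp

lemma gap_has_derivative:
  assumes i: "i \<in> {J..<N}" and t: "0 < t"
  shows "(gap x i has_real_derivative gap_rate i t) (at t)"
proof -
  have "(gap x i has_real_derivative (vbar + (\<Sum>k=Suc i..<N. a (Suc i) k t * u k t))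
      - (vbar + (\<Sum>k=i..<N. a i k t * u k t))) (at t)"
    unfolding gap_def[abs_def] Suc_eq_plus1[symmetric]
    using i t by (intro DERIV_diff x_has_derivative) auto
  moreover have "(\<Sum>k=i..<N. a i k t * u k t) =
      W (gap x i t) * u i t + (\<Sum>k=Suc i..<N. a i k t * u k t)"
    using i by (subst sum.atLeast_Suc_lessThan) (auto simp: a_def gap_def)
  ultimately show ?thesis
    by (simp add: gap_rate_def left_diff_distrib sum_subtractf algebra_simps)
qed

lemma gap_continuous: "i < N \<Longrightarrow> S \<subseteq> {0..} \<Longrightarrow> continuous_on S (gap x i)"
  unfolding gap_def[abs_def]
  by (intro continuous_intros continuous_on_subset[OF x_continuous]) auto

lemma a_nonneg: "i \<le> k \<Longrightarrow> k < N \<Longrightarrow> 0 \<le> t \<Longrightarrow> 0 \<le> a i k t"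
  using W_mono[of "x k t - x i t" "x (Suc k) t - x i t"] x_mono[of i k t] x_mono[of k "Suc k" t]
  by (simp add: a_def)

lemma a_increasing:
  assumes "Suc i \<le> k" "k < N" "0 \<le> t"
  shows "a i k t \<le> a (Suc i) k t"
  using W_concave[of "x k t - x (Suc i) t" "x (Suc k) t - x (Suc i) t" "gap x i t"]
    x_mono[of "Suc i" k t] x_mono[of k "Suc k" t] gap_pos[of i t] assms
  by (simp add: a_def gap_def)

lemma sum_a_increment:
  assumes "i < N"
  shows "(\<Sum>k=Suc i..<N. a (Suc i) k t - a i k t) =
    W (x N t - x (Suc i) t) - W (x N t - x i t) + W (gap x i t)"
  using sum_a[of "Suc i" i t] sum_a[of "Suc i" "Suc i" t] assms
  by (simp add: sum_subtractf gap_def)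

text \<open>The common estimate behind the maximum principles and the decay: by the signs of the
  weights, replacing every \<open>s * u\<close> by the separating level \<open>c\<close> can only
  raise the rate, and the weights then telescope.\<close>

lemma gap_rate_le:
  assumes i: "i < N" and t: "0 \<le> t"
    and c: "\<And>k. k \<in> {Suc i..<N} \<Longrightarrow> s * u k t \<le> c" "c \<le> s * u i t"
  shows "s * gap_rate i t \<le> - c * (W (x N t - x i t) - W (x N t - x (Suc i) t))"
proof -
  have "s * gap_rate i t =
      (\<Sum>k=Suc i..<N. (a (Suc i) k t - a i k t) * (s * u k t)) - W (gap x i t) * (s * u i t)"
    by (simp add: gap_rate_def algebra_simps sum_distrib_left)
  also have "\<dots> \<le> (\<Sum>k=Suc i..<N. (a (Suc i) k t - a i k t) * c) - W (gap x i t) * c"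
    using c a_increasing W_nonneg[of "gap x i t"] gap_pos[OF i t] i t
    by (intro diff_mono sum_mono mult_left_mono) auto
  also have "\<dots> = - c * (W (x N t - x i t) - W (x N t - x (Suc i) t))"
    unfolding sum_distrib_right[symmetric] sum_a_increment[OF i] by (simp add: algebra_simps)
  finally show ?thesis .
qed

section \<open>Maximum principles for densities, gaps and platoon length\<close>

lemma backward_induct:
  assumes "\<And>i. i \<in> {J..<N} \<Longrightarrow> (\<And>k. k \<in> {Suc i..<N} \<Longrightarrow> P k) \<Longrightarrow> P i"
    and "i \<in> {J..<N}"
  shows "P i"
  using assms(2)
proof (induction "N - i" arbitrary: i rule: less_induct)
  case less
  show ?case by (rule assms(1)) (use less in auto)
qed

lemma rho_pos: "i < N \<Longrightarrow> 0 \<le> t \<Longrightarrow> 0 < rho i t"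
  using gap_pos N_pos by (simp add: rho_def)

lemma Lbar_pos: "Lbar > 0"
  using equilibrium by (simp add: equilibrium_gap_def)

lemma rho_bar: "0 < rho_bar" "rho_bar \<le> rho_max om" "v rho_bar om = vbar"
  using equilibrium N_pos by (auto simp: equilibrium_gap_def rho_bar_def)

lemma v_antimono: "0 \<le> r \<Longrightarrow> r \<le> r' \<Longrightarrow> r' \<le> rho_max om \<Longrightarrow> v r' om \<le> v r om"
  using v_slope[OF om_pos slope, of r r'] slope_neg
  by (smt (verit) mult_nonneg_nonneg mult_minus_left)

lemma rho_le_iff:
  assumes "i < N" "k < N" "0 \<le> t" "0 \<le> s"
  shows "rho i t \<le> rho k s \<longleftrightarrow> gap x k s \<le> gap x i t"
  using assms gap_pos[of i t] gap_pos[of k s] N_pos by (simp add: rho_def field_simps)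

lemma rho_le_rho_bar_iff: "i < N \<Longrightarrow> 0 \<le> t \<Longrightarrow> rho i t \<le> rho_bar \<longleftrightarrow> Lbar \<le> gap x i t"
  and rho_bar_le_rho_iff: "i < N \<Longrightarrow> 0 \<le> t \<Longrightarrow> rho_bar \<le> rho i t \<longleftrightarrow> gap x i t \<le> Lbar"
  using gap_pos[of i t] Lbar_pos N_pos by (auto simp: rho_def rho_bar_def field_simps)

text \<open>
  The density cannot leave the admissible range: as soon as it is slightly above the maximal one,
  the car is slower than all admissible cars ahead, and its gap grows.
\<close>

lemma rho_admissible:
  assumes "i \<in> {J..<N}" "0 \<le> t"
  shows "rho i t \<le> rho_max om"
proof -
  define R where "R = rho_max om"
  have R: "R > 0" using rho_max_pos om_pos by (simp add: R_def)
  \<comment> \<open>Above \<open>R\<close> the density is no longer admissible; only the negative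
    derivative at \<open>R\<close> itself gives \<open>v < 0\<close>, on a short interval.\<close>
  have "\<exists>d>0. \<forall>h>0. R + h \<in> {0..} \<longrightarrow> h < d \<longrightarrow> v (R + h) om < v R om"
    using slope[of R] slope_neg R
    by (intro has_real_derivative_neg_dec_right[OF v_has_derivative[OF om_pos]])
      (auto simp: R_def)
  then obtain d where d: "d > 0" "\<And>h. 0 < h \<Longrightarrow> h < d \<Longrightarrow> v (R + h) om < 0"
    using v_rho_max[OF om_pos] R by (auto simp: R_def)
  define y where "y = 1 / (real N * R)"
  \<comment> \<open>The density strip from \<open>R\<close> to \<open>R + d\<close>, translated into
    gaps below \<open>y\<close>.\<close>
  define \<delta> where "\<delta> = y - 1 / (real N * (R + d))"
  have "1 / (real N * (R + d)) < 1 / (real N * R)"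
    using R d N_pos by (intro divide_strict_left_mono mult_strict_left_mono mult_pos_pos) auto
  then have \<delta>: "\<delta> > 0" by (simp add: \<delta>_def y_def)
  have rho_iff: "rho i t \<le> R \<longleftrightarrow> y \<le> gap x i t" if "i \<in> {J..<N}" "0 \<le> t" for i t
    using that gap_pos[of i t] R N_pos by (auto simp: rho_def y_def field_simps)
  have "\<forall>t\<ge>0. y - gap x i t \<le> 0"
  proof (rule backward_induct[OF _ assms(1)], intro allI impI)
    fix i and t :: real
    assume i: "i \<in> {J..<N}" and ahead: "\<And>k. k \<in> {Suc i..<N} \<Longrightarrow> \<forall>t\<ge>0. y - gap x k t \<le> 0"
      and t: "0 \<le> t"
    show "y - gap x i t \<le> 0"
    proof (rule barrier_le_zero[where T = t and \<delta> = \<delta> and K = 0 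
          and f = "\<lambda>s. y - gap x i s" and f' = "\<lambda>s. - gap_rate i s"])
      show "continuous_on {0..t} (\<lambda>s. y - gap x i s)"
        using i by (intro continuous_intros gap_continuous) auto
      show "y - gap x i 0 \<le> 0"
        using initial_admissible[of i] rho_iff[OF i, of 0] marker[OF i] i
        by (simp add: rho_def R_def)
      fix s assume s: "0 < s" "s \<le> t"
      show "((\<lambda>s. y - gap x i s) has_real_derivative - gap_rate i s) (at s)"
        using gap_has_derivative[OF i s(1)] by (auto intro!: derivative_eq_intros)
      assume f: "0 < y - gap x i s" "y - gap x i s < \<delta>"
      have "rho i s < R + d"
      proof -
        have "1 / (real N * (R + d)) < gap x i s" using f by (simp add: \<delta>_def)
        moreover have "0 < real N * (R + d)" using R d N_pos by simp
        ultimately have "1 < gap x i s * (real N * (R + d))" by (simp add: divide_less_eq)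
        then show ?thesis
          using gap_pos[of i s] i s N_pos by (simp add: rho_def divide_less_eq mult_ac)
      qed
      moreover have "R < rho i s" using rho_iff[OF i, of s] f s by simp
      ultimately have slow: "u i s \<le> - vbar" using d(2)[of "rho i s - R"] by (simp add: u_def)
      have "- vbar \<le> u k s" if "k \<in> {Suc i..<N}" for k
        using v_nonneg[OF om_pos, of "rho k s"] rho_iff[of k s] ahead[OF that] rho_pos[of k s] that i s
        by (simp add: u_def R_def)
      then have "- 1 * gap_rate i s \<le> - vbar * (W (x N s - x i s) - W (x N s - x (Suc i) s))"
        using gap_rate_le[of i s "-1" vbar] slow i s by force
      also have "\<dots> \<le> 0"
        using W_mono[of "x N s - x (Suc i) s" "x N s - x i s"] x_mono[of "Suc i" N s]
          x_mono[of i "Suc i" s] vbar_pos i s by simp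
      finally show "- gap_rate i s \<le> 0 * (y - gap x i s)" by simp
    qed (use t \<delta> in auto)
  qed
  then show ?thesis using rho_iff assms by (simp add: R_def)
qed

lemma u_mono:
  assumes "i \<in> {J..<N}" "k \<in> {J..<N}" "0 \<le> t" "gap x i t \<le> gap x k t"
  shows "u i t \<le> u k t"
  using v_antimono[of "rho k t" "rho i t"] rho_le_iff[of k i t t] rho_pos[of k t]
    rho_admissible[of i t] assms by (simp add: u_def)

lemma u_nonneg:
  assumes "i \<in> {J..<N}" "0 \<le> t" "Lbar \<le> gap x i t"
  shows "0 \<le> u i t"
  using v_antimono[of "rho i t" rho_bar] rho_le_rho_bar_iff[of i t] rho_pos[of i t] rho_bar assms
  by (simp add: u_def)

lemma u_nonpos:
  assumes "i \<in> {J..<N}" "0 \<le> t" "gap x i t \<le> Lbar"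
  shows "u i t \<le> 0"
  using v_antimono[of rho_bar "rho i t"] rho_bar_le_rho_iff[of i t] rho_admissible[of i t] rho_bar
    assms by (simp add: u_def)

lemma u_bound:
  assumes "i \<in> {J..<N}" "0 \<le> t"
  shows "\<bar>u i t\<bar> \<le> om + vbar"
  using v_antimono[of 0 "rho i t"] v_nonneg[OF om_pos, of "rho i t"] v_empty[OF om_pos]
    rho_admissible[of i t] rho_pos[of i t] vbar_pos om_pos assms by (simp add: u_def)

lemma sg_u_mono:
  assumes "i \<in> {J..<N}" "k \<in> {J..<N}" "0 \<le> t" "sg * gap x i t \<le> sg * gap x k t"
  shows "sg * u i t \<le> sg * u k t"
  using sg u_mono[of i k t] u_mono[of k i t] assms by auto

text \<open>Stated for either sign: \<open>side\<close> uses \<open>sg\<close> for the cars ahead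
  and \<open>- sg\<close> for the car supposed to have crossed \<open>Lbar\<close>.\<close>

lemma signed_u_nonneg:
  assumes "c = 1 \<or> c = -1" "i \<in> {J..<N}" "0 \<le> t" "0 \<le> c * (gap x i t - Lbar)"
  shows "0 \<le> c * u i t"
  using assms(1)
proof
  assume c: "c = 1"
  then show ?thesis using u_nonneg[of i t] assms(2-) by simp
next
  assume c: "c = -1"
  then show ?thesis using u_nonpos[of i t] assms(2-) by simp
qed

text \<open>While the cars ahead are on the right side, a gap that has crossed \<open>Lbar\<close>
  is pushed back by its own speed and by theirs, so the violation cannot grow.\<close>

lemma side:
  assumes "i \<in> {J..<N}" "0 \<le> t"
  shows "0 \<le> sg * (gap x i t - Lbar)"
proof -
  have "\<forall>t\<ge>0. 0 \<le> sg * (gap x i t - Lbar)"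
  proof (rule backward_induct[OF _ assms(1)], intro allI impI)
    fix i and t :: real
    assume i: "i \<in> {J..<N}" and t: "0 \<le> t"
      and ahead: "\<And>k. k \<in> {Suc i..<N} \<Longrightarrow> \<forall>t\<ge>0. 0 \<le> sg * (gap x k t - Lbar)"
    have "- (sg * (gap x i t - Lbar)) \<le> 0"
    proof (rule barrier_le_zero[where T = t and \<delta> = 1 and K = 0
          and f = "\<lambda>s. - (sg * (gap x i s - Lbar))" and f' = "\<lambda>s. - (sg * gap_rate i s)"])
      show "continuous_on {0..t} (\<lambda>s. - (sg * (gap x i s - Lbar)))"
        using i by (intro continuous_intros gap_continuous) auto
      show "- (sg * (gap x i 0 - Lbar)) \<le> 0" using side_init[OF i] by simp
      fix s assume s: "0 < s" "s \<le> t"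
      show "((\<lambda>s. - (sg * (gap x i s - Lbar))) has_real_derivative - (sg * gap_rate i s)) (at s)"
        using gap_has_derivative[OF i s(1)] by (auto intro!: derivative_eq_intros)
      assume f: "0 < - (sg * (gap x i s - Lbar))"
      have "(- sg) * u k s \<le> 0" if "k \<in> {Suc i..<N}" for k
        using signed_u_nonneg[OF sg, of k s] ahead[OF that] that i s by simp
      moreover have "0 \<le> (- sg) * u i s"
        using sg f s by (intro signed_u_nonneg[OF _ i]) auto
      ultimately have "(- sg) * gap_rate i s \<le> - 0 * (W (x N s - x i s) - W (x N s - x (Suc i) s))"
        using i s by (intro gap_rate_le) auto
      then show "- (sg * gap_rate i s) \<le> 0 * - (sg * (gap x i s - Lbar))" by simp
    qed (use t in auto)
    then show "0 \<le> sg * (gap x i t - Lbar)" by simp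
  qed
  then show ?thesis using assms by simp
qed

lemma sg_u_nonneg: "i \<in> {J..<N} \<Longrightarrow> 0 \<le> t \<Longrightarrow> 0 \<le> sg * u i t"
  using signed_u_nonneg[OF sg] side by blast

text \<open>For \<open>sg = 1\<close> car \<open>J\<close> is at least as fast as the leader, so the
  length does not exceed its initial value; for \<open>sg = -1\<close> every gap is at most
  \<open>Lbar\<close>.\<close>

lemma length_le_eta:
  assumes t: "0 \<le> t"
  shows "x N t - x J t \<le> eta"
proof (cases "sg = 1")
  case True
  have "x N t - x J t \<le> x N 0 - x J 0"
  proof (rule DERIV_nonpos_imp_decreasing_open[where f = "\<lambda>t. x N t - x J t"])
    show "continuous_on {0..t} (\<lambda>t. x N t - x J t)"
      using J_less by (intro continuous_intros continuous_on_subset[OF x_continuous]) auto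
    fix s assume s: "0 < s" "s < t"
    have "((\<lambda>t. x N t - x J t) has_real_derivative
        (vbar + (\<Sum>k=N..<N. a N k s * u k s)) - (vbar + (\<Sum>k=J..<N. a J k s * u k s))) (at s)"
      using J_less s by (intro DERIV_diff x_has_derivative) auto
    moreover have "0 \<le> (\<Sum>k=J..<N. a J k s * u k s)"
      using a_nonneg sg_u_nonneg True s by (intro sum_nonneg mult_nonneg_nonneg) auto
    ultimately show "\<exists>y. ((\<lambda>t. x N t - x J t) has_real_derivative y) (at s) \<and> y \<le> 0"
      by fastforce
  qed (fact t)
  also have "\<dots> = (\<Sum>i=J..<N. gap x i 0)" using length_eq_sum_gaps J_less by simp
  also have "\<dots> \<le> (\<Sum>i=J..<N. max (gap x i 0) Lbar)" by (intro sum_mono) simp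
  finally show ?thesis using length_init by simp
next
  case False
  have "x N t - x J t = (\<Sum>i=J..<N. gap x i t)" using length_eq_sum_gaps J_less by simp
  also have "\<dots> \<le> (\<Sum>i=J..<N. max (gap x i 0) Lbar)"
  proof (rule sum_mono)
    fix i assume "i \<in> {J..<N}"
    then show "gap x i t \<le> max (gap x i 0) Lbar" using side[of i t] sg False t by auto
  qed
  finally show ?thesis using length_init by simp
qed

lemma distance_le_eta:
  assumes "J \<le> i" "i \<le> k" "k \<le> N" "0 \<le> t"
  shows "x k t - x i t \<le> eta"
  using length_le_eta[of t] x_mono[of J i t] x_mono[of k N t] assms by simp

section \<open>Preservation of the order of the gaps\<close>

text \<open>Grouped for sign control in \<open>order\<close>: second differences of \<open>W\<close>
  for cars further ahead, the nearby term of car \<open>Suc i\<close>, and the speed difference of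
  the two cars.\<close>

lemma gap_difference_rate:
  assumes "Suc i < N"
  shows "gap_rate (Suc i) t - gap_rate i t =
    - (\<Sum>k=Suc (Suc i)..<N. (2 * a (Suc i) k t - a i k t - a (Suc (Suc i)) k t) * u k t)
    - (2 * W (gap x (Suc i) t) - W (gap x i t + gap x (Suc i) t)) * u (Suc i) t
    - W (gap x i t) * (u (Suc i) t - u i t)"
proof -
  define S where "S m = (\<Sum>k=Suc (Suc i)..<N. (a (Suc m) k t - a m k t) * u k t)" for m
  have "gap_rate i t = (a (Suc i) (Suc i) t - a i (Suc i) t) * u (Suc i) t + S i
      - W (gap x i t) * u i t"
    unfolding gap_rate_def S_def using assms by (subst sum.atLeast_Suc_lessThan) auto
  moreover have "a (Suc i) (Suc i) t = W (gap x (Suc i) t)"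
    "a i (Suc i) t = W (gap x i t + gap x (Suc i) t) - W (gap x i t)"
    by (simp_all add: a_def gap_def)
  moreover have "gap_rate (Suc i) t = S (Suc i) - W (gap x (Suc i) t) * u (Suc i) t"
    by (simp add: gap_rate_def S_def)
  moreover have
    "(\<Sum>k=Suc (Suc i)..<N. (2 * a (Suc i) k t - a i k t - a (Suc (Suc i)) k t) * u k t) =
      S i - S (Suc i)"
    unfolding S_def sum_subtractf[symmetric] by (intro sum.cong) (auto simp: algebra_simps)
  ultimately show ?thesis by (simp only:) (simp add: algebra_simps)
qed

text \<open>
  Every term of the rate of the violation \<open>d = sg * (gap x (Suc i) - gap x i)\<close> is
  nonpositive up to an error of order \<open>d\<close>.  So no car has to be compared with more than
  its immediate leader.
\<close>

lemma order:
  assumes i: "J \<le> i" "Suc i < N" and t: "0 \<le> t"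
  shows "sg * (gap x (Suc i) t - gap x i t) \<le> 0"
proof -
  obtain K where K: "K \<ge> 0"
    "\<And>a b. a \<in> {0..eta} \<Longrightarrow> b \<in> {0..eta} \<Longrightarrow> \<bar>w a - w b\<bar> \<le> K * \<bar>a - b\<bar>"
    using w_lipschitz by blast
  define B where "B = om + vbar"
  have B: "0 \<le> sg * u k s" "sg * u k s \<le> B" if "k \<in> {J..<N}" "0 \<le> s" for k s
    using sg_u_nonneg[OF that] u_bound[OF that] sg by (auto simp: B_def)
  have B_pos: "B > 0" using om_pos vbar_pos by (simp add: B_def)
  have w0: "w 0 \<ge> 0" using w_nonneg eta_pos by simp
  let ?d = "\<lambda>s. sg * (gap x (Suc i) s - gap x i s)"
  \<comment> \<open>In the rate, \<open>K * eta * B\<close> comes from the cars further ahead and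
    \<open>w 0 * B\<close> from car \<open>Suc i\<close>.\<close>
  show ?thesis
  proof (rule barrier_le_zero[where T = t and \<delta> = 1 and K = "K * eta * B + w 0 * B"
        and f' = "\<lambda>s. sg * (gap_rate (Suc i) s - gap_rate i s)" and f = ?d])
    show "continuous_on {0..t} ?d"
      using i by (intro continuous_intros gap_continuous) auto
    show "?d 0 \<le> 0" using order_init i by simp
    fix s assume s: "0 < s" "s \<le> t"
    show "(?d has_real_derivative sg * (gap_rate (Suc i) s - gap_rate i s)) (at s)"
      using gap_has_derivative[of i s] gap_has_derivative[of "Suc i" s] i s
      by (auto intro!: derivative_eq_intros)
    assume d: "0 < ?d s"
    define y where "y = gap x i s"
    define z where "z = gap x (Suc i) s"
    have y: "y > 0" and z: "z > 0" using gap_pos i s by (auto simp: y_def z_def)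
    \<comment> \<open>One of the two mismatches equals the violation and the other is 0, depending
      on \<open>sg\<close>.\<close>
    have yz: "max 0 (y - z) \<le> ?d s" "max 0 (z - y) \<le> ?d s"
      using sg d by (auto simp: y_def z_def)
    have far: "- (K * ?d s * B * gap x k s) \<le>
        (2 * a (Suc i) k s - a i k s - a (Suc (Suc i)) k s) * (sg * u k s)"
      (is "_ \<le> ?c * _") if k: "k \<in> {Suc (Suc i)..<N}" for k
    proof -
      \<comment> \<open>Measured from car \<open>Suc i\<close>, the views of cars \<open>i\<close>
        and \<open>Suc (Suc i)\<close> are shifts by \<open>y\<close> to the right and by
        \<open>z\<close> to the left.\<close>
      let ?p = "x k s - x (Suc i) s" and ?q = "x (Suc k) s - x (Suc i) s"
      have "- (K * max 0 (z - y) * (?q - ?p)) \<le>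
          2 * (W ?q - W ?p) - (W (?q - z) - W (?p - z)) - (W (?q + y) - W (?p + y))"
      proof (rule W_second_difference[OF w_concave K])
        show "z \<le> ?p" "?p \<le> ?q"
          using x_mono[of "Suc (Suc i)" k s] x_mono[of k "Suc k" s] k s
          by (auto simp: z_def gap_def)
        show "?q + y \<le> eta"
          using distance_le_eta[of i "Suc k" s] i k s by (simp add: y_def gap_def)
      qed (use y z in auto)
      also have "\<dots> = ?c" by (simp add: a_def y_def z_def gap_def)
      finally have c: "- (K * max 0 (z - y) * gap x k s) \<le> ?c" by (simp add: gap_def)
      have g: "0 \<le> gap x k s" using gap_pos[of k s] k s by simp
      then have "K * max 0 (z - y) * gap x k s \<le> K * ?d s * gap x k s"
        using yz K by (intro mult_right_mono mult_left_mono) auto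
      then have "- (K * ?d s * gap x k s) * (sg * u k s) \<le> ?c * (sg * u k s)"
        using c B[of k s] i k s by (intro mult_right_mono) auto
      moreover have "(K * ?d s * gap x k s) * (sg * u k s) \<le> (K * ?d s * gap x k s) * B"
        using B[of k s] K d g i k s
        by (intro mult_left_mono mult_nonneg_nonneg[OF mult_nonneg_nonneg]) auto
      ultimately show ?thesis by (simp add: algebra_simps)
    qed
    have "(\<Sum>k=Suc (Suc i)..<N. gap x k s) \<le> eta"
      using length_eq_sum_gaps[of "Suc (Suc i)" N s] distance_le_eta[of "Suc (Suc i)" N s] i s by simp
    then have "K * ?d s * B * (\<Sum>k=Suc (Suc i)..<N. gap x k s) \<le> K * ?d s * B * eta"
      using K d B_pos by (intro mult_left_mono mult_nonneg_nonneg[OF mult_nonneg_nonneg]) auto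
    moreover have "(\<Sum>k=Suc (Suc i)..<N. - (K * ?d s * B * gap x k s)) \<le>
        (\<Sum>k=Suc (Suc i)..<N. (2 * a (Suc i) k s - a i k s - a (Suc (Suc i)) k s) * (sg * u k s))"
      by (intro sum_mono far)
    ultimately have far_sum: "- (K * ?d s * B * eta) \<le>
        (\<Sum>k=Suc (Suc i)..<N. (2 * a (Suc i) k s - a i k s - a (Suc (Suc i)) k s) * (sg * u k s))"
      by (simp add: sum_negf sum_distrib_left)
    \<comment> \<open>Concavity with \<open>W 0 = 0\<close> gives
      \<open>W (2 * z) \<le> 2 * W z\<close>; an excess of \<open>y\<close> over \<open>z\<close>
      costs at most \<open>w 0\<close> per unit length.\<close>
    have "W (y + z) \<le> 2 * W z + w 0 * ?d s"
    proof -
      have "W (y + z) - W (z + z) \<le> w 0 * max 0 (y - z)"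
        using W_diff_le[of "z + z" "y + z"] W_mono[of "y + z" "z + z"] y z
        by (cases "z \<le> y") (auto simp: algebra_simps)
      also have "\<dots> \<le> w 0 * ?d s" using yz w0 by (intro mult_left_mono)
      finally show ?thesis using W_concave[of 0 z z] z by simp
    qed
    then have "- (w 0 * ?d s) * (sg * u (Suc i) s) \<le> (2 * W z - W (y + z)) * (sg * u (Suc i) s)"
      using B[of "Suc i" s] i s by (intro mult_right_mono) auto
    moreover have "w 0 * ?d s * (sg * u (Suc i) s) \<le> w 0 * ?d s * B"
      using B[of "Suc i" s] i s mult_nonneg_nonneg[OF w0 less_imp_le[OF d]]
      by (intro mult_left_mono) auto
    ultimately have near: "- (w 0 * ?d s * B) \<le> (2 * W z - W (y + z)) * (sg * u (Suc i) s)"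
      by simp
    \<comment> \<open>A violated order also orders the speeds, which gives the last term its good
      sign.\<close>
    have "sg * u i s \<le> sg * u (Suc i) s"
      using d i s by (intro sg_u_mono) (auto simp: algebra_simps)
    then have "0 \<le> W y * (sg * u (Suc i) s - sg * u i s)"
      using W_nonneg[of y] y by simp
    moreover have "sg * (gap_rate (Suc i) s - gap_rate i s) =
      - (\<Sum>k=Suc (Suc i)..<N. (2 * a (Suc i) k s - a i k s - a (Suc (Suc i)) k s) * (sg * u k s))
      - (2 * W z - W (y + z)) * (sg * u (Suc i) s) - W y * (sg * u (Suc i) s - sg * u i s)"
      unfolding gap_difference_rate[OF i(2)] y_def z_def
      by (simp add: right_diff_distrib sum_distrib_left mult_ac)
    ultimately have "sg * (gap_rate (Suc i) s - gap_rate i s) \<le> K * ?d s * B * eta + w 0 * ?d s * B"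
      using far_sum near by linarith
    then show "sg * (gap_rate (Suc i) s - gap_rate i s) \<le> (K * eta * B + w 0 * B) * ?d s"
      by (simp add: algebra_simps)
  qed (use t in auto)
qed

lemma order_chain:
  assumes "J \<le> i" "i \<le> k" "k < N" "0 \<le> t"
  shows "sg * gap x k t \<le> sg * gap x i t"
  using assms(2,3)
proof (induction k rule: dec_induct)
  case (step k)
  then show ?case using order[of k t] assms by (simp add: right_diff_distrib)
qed simp

section \<open>Decay of the Lyapunov function\<close>

text \<open>With ordered gaps \<open>sg * u\<close> is largest at \<open>i\<close> among the cars
  from \<open>i\<close> on, so \<open>sg * u i\<close> serves as the level \<open>c\<close>. The
  telescoped weight is an integral of \<open>w\<close> over a stretch of length
  \<open>gap x i\<close> within the platoon length.\<close>

lemma sg_gap_rate_le: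
  assumes i: "i \<in> {J..<N}" and t: "0 \<le> t"
  shows "sg * gap_rate i t \<le> - (sg * u i t * gap x i t * w (x N t - x J t))"
proof -
  have "sg * gap_rate i t \<le> - (sg * u i t) * (W (x N t - x i t) - W (x N t - x (Suc i) t))"
    using order_chain[of i _ t] i t by (intro gap_rate_le) (auto intro!: sg_u_mono)
  also have "\<dots> \<le> - (sg * u i t) * (gap x i t * w (x N t - x J t))"
  proof (intro mult_left_mono_neg)
    have "gap x i t * w (x N t - x J t) \<le> gap x i t * w (x N t - x i t)"
      using w_decreasing[of "x N t - x i t" "x N t - x J t"] gap_pos[of i t] x_mono[of J i t]
        x_mono[of i N t] length_le_eta[OF t] i t by (intro mult_left_mono) auto
    also have "\<dots> \<le> W (x N t - x i t) - W (x N t - x (Suc i) t)"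
      using W_diff_ge[of "x N t - x (Suc i) t" "x N t - x i t"] x_mono[of "Suc i" N t]
        x_mono[of i "Suc i" t] distance_le_eta[of i N t] i t by (simp add: gap_def)
    finally show "gap x i t * w (x N t - x J t) \<le> W (x N t - x i t) - W (x N t - x (Suc i) t)" .
    show "- (sg * u i t) \<le> 0" using sg_u_nonneg[OF i t] by simp
  qed
  finally show ?thesis by (simp add: mult_ac)
qed

lemma w_length_nonneg: "0 \<le> t \<Longrightarrow> 0 \<le> w (x N t - x J t)"
  using length_le_eta[of t] x_mono[of J N t] J_less by (intro w_nonneg) auto

text \<open>For \<open>sg = 1\<close> the gap shrinks and the density rises from its initial value;
  for \<open>sg = -1\<close> the density stays above \<open>rho_bar\<close>.\<close>

lemma rho_ge:
  assumes i: "i \<in> {J..<N}" and t: "0 \<le> t" and r: "r \<le> rho i 0" "r \<le> rho_bar"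
  shows "r \<le> rho i t"
proof (cases "sg = 1")
  case True
  have "gap x i t \<le> gap x i 0"
  proof (rule DERIV_nonpos_imp_decreasing_open[where f = "gap x i"])
    show "continuous_on {0..t} (gap x i)" using i by (intro gap_continuous) auto
    fix s assume s: "0 < s" "s < t"
    have "0 \<le> sg * u i s * gap x i s * w (x N s - x J s)"
      using sg_u_nonneg[OF i, of s] gap_pos[of i s] w_length_nonneg[of s] i s True by simp
    then have "gap_rate i s \<le> 0" using sg_gap_rate_le[OF i, of s] s True by simp
    then show "\<exists>y. (gap x i has_real_derivative y) (at s) \<and> y \<le> 0"
      using gap_has_derivative[OF i s(1)] by blast
  qed (fact t)
  then show ?thesis using rho_le_iff[of i i 0 t] i t r by simp
next
  case False
  then have "gap x i t \<le> Lbar" using side[OF i t] sg by auto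
  then show ?thesis using rho_bar_le_rho_iff[of i t] i t r by simp
qed

lemma lyapunov_term_rate_le:
  assumes i: "i \<in> {J..<N}" and t: "0 \<le> t" and r: "r \<le> rho i 0" "r \<le> rho_bar"
  shows "(rho_bar - rho i t) * (rho_bar + rho i t) * gap_rate i t \<le>
    2 * slope * r * w (x N t - x J t) * (gap x i t * (rho i t - rho_bar)\<^sup>2)"
proof -
  let ?e = "rho_bar - rho i t" and ?\<omega> = "w (x N t - x J t)" and ?y = "gap x i t"
  have y: "?y > 0" and rho: "rho i t > 0" using gap_pos rho_pos i t by auto
  have side_rho: "0 \<le> sg * ?e"
    using side[OF i t] sg rho_le_rho_bar_iff[of i t] rho_bar_le_rho_iff[of i t] i t by auto
  \<comment> \<open>Both cases are the secant bound \<open>v_slope\<close>, with the two densities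
    exchanged.\<close>
  have "- slope * ?e\<^sup>2 \<le> ?e * u i t"
  proof (cases "rho i t \<le> rho_bar")
    case True
    then have "?e * (- slope * ?e) \<le> ?e * u i t"
      using v_slope[OF om_pos slope, of "rho i t" rho_bar] rho rho_bar
      by (intro mult_left_mono) (auto simp: u_def)
    then show ?thesis by (simp add: power2_eq_square mult_ac)
  next
    case False
    then have "- ?e * (- slope * - ?e) \<le> - ?e * - u i t"
      using v_slope[OF om_pos slope, of rho_bar "rho i t"] rho_admissible[OF i t] rho_bar
      by (intro mult_left_mono) (auto simp: u_def)
    then show ?thesis by (simp add: power2_eq_square algebra_simps)
  qed
  then have drift: "?e * u i t * (?y * ?\<omega>) \<ge> - slope * ?e\<^sup>2 * (?y * ?\<omega>)"
    using y w_length_nonneg[OF t] by (intro mult_right_mono mult_nonneg_nonneg) auto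
  have "?e * gap_rate i t = (sg * ?e) * (sg * gap_rate i t)"
    using sg by auto
  also have "\<dots> \<le> (sg * ?e) * - (sg * u i t * ?y * ?\<omega>)"
    using side_rho sg_gap_rate_le[OF i t] by (rule mult_left_mono[rotated])
  also have "\<dots> = - (?e * u i t * (?y * ?\<omega>))"
    using sg by auto
  also have "\<dots> \<le> slope * ?e\<^sup>2 * (?y * ?\<omega>)"
    using drift by simp
  finally have "(rho_bar + rho i t) * (?e * gap_rate i t) \<le>
      (rho_bar + rho i t) * (slope * ?e\<^sup>2 * (?y * ?\<omega>))"
    using rho rho_bar by (intro mult_left_mono) auto
  \<comment> \<open>The second factor is nonpositive, so lowering the first one to
    \<open>2 * r\<close> raises the product.\<close>
  also have "\<dots> \<le> (2 * r) * (slope * ?e\<^sup>2 * (?y * ?\<omega>))"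
  proof (rule mult_right_mono_neg)
    show "2 * r \<le> rho_bar + rho i t" using rho_ge[OF i t r] r by simp
    have "0 \<le> ?e\<^sup>2 * (?y * ?\<omega>)" using y w_length_nonneg[OF t] by simp
    then show "slope * ?e\<^sup>2 * (?y * ?\<omega>) \<le> 0"
      using slope_neg by (simp add: mult.assoc mult_nonpos_nonneg)
  qed
  finally show ?thesis by (simp add: power2_commute[of rho_bar] mult_ac)
qed

text \<open>As a function of the gap the term has derivative
  \<open>(rho - rho_bar)\<^sup>2 - 2 * rho * (rho - rho_bar)\<close>, that is
  \<open>rho_bar\<^sup>2 - rho\<^sup>2\<close>.\<close>

lemma lyapunov_term_has_derivative:
  assumes i: "i \<in> {J..<N}" and t: "0 < t"
  shows "((\<lambda>t. gap x i t * (rho i t - rho_bar)\<^sup>2) has_real_derivative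
    (rho_bar - rho i t) * (rho_bar + rho i t) * gap_rate i t) (at t)"
proof -
  have y: "gap x i t \<noteq> 0" using gap_pos[of i t] i t by simp
  have "(\<lambda>s. 1 / real N * inverse (gap x i s)) = rho i"
    by (simp add: fun_eq_iff rho_def inverse_eq_divide)
  moreover have "1 / real N * - (inverse (gap x i t) * gap_rate i t * inverse (gap x i t)) =
      - (rho i t * gap_rate i t / gap x i t)"
    using y N_pos by (simp add: rho_def inverse_eq_divide)
  ultimately have "(rho i has_real_derivative - (rho i t * gap_rate i t / gap x i t)) (at t)"
    using DERIV_cmult[OF DERIV_inverse'[OF gap_has_derivative[OF i t] y], of "1 / real N"]
    by simp
  from DERIV_mult[OF gap_has_derivative[OF i t] DERIV_power[where n = 2,
      OF DERIV_diff[OF this DERIV_const[of rho_bar]]]]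
  have "((\<lambda>t. gap x i t * (rho i t - rho_bar)\<^sup>2) has_real_derivative
    gap_rate i t * (rho i t - rho_bar)\<^sup>2 +
    2 * (- (rho i t * gap_rate i t / gap x i t) * (rho i t - rho_bar)) * gap x i t) (at t)"
    by simp
  moreover have "gap_rate i t * (rho i t - rho_bar)\<^sup>2 +
    2 * (- (rho i t * gap_rate i t / gap x i t) * (rho i t - rho_bar)) * gap x i t =
    (rho_bar - rho i t) * (rho_bar + rho i t) * gap_rate i t"
    using y by (simp add: power2_eq_square) algebra
  ultimately show ?thesis by simp
qed

text \<open>Gronwall's argument: summing the termwise rate bounds shows that \<open>E\<close> times
  the integrating factor \<open>exp (- (2 * slope * r * I s))\<close> is nonincreasing.\<close>

lemma lyapunov_decay:
  assumes L: "\<And>i. i \<in> {J..<N} \<Longrightarrow> L i = Lbar" and t: "0 \<le> t"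
    and r: "r \<le> rho_bar" "\<And>i. i \<in> {J..<N} \<Longrightarrow> r \<le> rho i 0"
  shows "lyapunov N J x L t \<le>
    lyapunov N J x L 0 * exp (2 * slope * r * integral {0..t} (\<lambda>s. w (x N s - x J s)))"
proof -
  define E where "E s = (\<Sum>i=J..<N. gap x i s * (rho i s - rho_bar)\<^sup>2)" for s
  define I where "I s = integral {0..s} (\<lambda>s. w (x N s - x J s))" for s
  define G where "G s = E s * exp (- (2 * slope * r * I s))" for s
  have lyap: "lyapunov N J x L s = E s" for s
    unfolding lyapunov_def E_def rho_def rho_bar_def using L by (intro sum.cong) auto
  \<comment> \<open>\<open>w\<close> is continuous only on \<open>{0..eta}\<close>, which the
    platoon length never leaves.\<close>
  have w_cont: "continuous_on {0..t} (\<lambda>s. w (x N s - x J s))"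
    using J_less length_le_eta x_mono[of J N]
    by (intro continuous_on_compose2[OF w_continuous] continuous_intros
        continuous_on_subset[OF x_continuous]) auto
  have "G t \<le> G 0"
  proof (rule DERIV_nonpos_imp_decreasing_open[where f = G])
    have "continuous_on {0..t} I"
      unfolding I_def
      by (intro indefinite_integral_continuous_1 integrable_continuous_real w_cont)
    moreover have "continuous_on {0..t} E"
      unfolding E_def rho_def using gap_pos N_pos
      by (intro continuous_intros gap_continuous) (fastforce simp: less_imp_neq)+
    ultimately show "continuous_on {0..t} G"
      unfolding G_def by (intro continuous_intros)
    fix s assume s: "0 < s" "s < t"
    let ?E' = "\<Sum>i=J..<N. (rho_bar - rho i s) * (rho_bar + rho i s) * gap_rate i s"
    let ?c = "2 * slope * r * w (x N s - x J s)"
    have "(I has_real_derivative w (x N s - x J s)) (at s within {0..t})"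
      unfolding I_def using s by (intro integral_has_real_derivative[OF w_cont]) auto
    moreover have "at s within {0..t} = at s"
      using s by (intro at_within_interior) auto
    ultimately have I: "(I has_real_derivative w (x N s - x J s)) (at s)" by simp
    have E: "(E has_real_derivative ?E') (at s)"
      unfolding E_def[abs_def] by (intro DERIV_sum lyapunov_term_has_derivative s)
    have "(G has_real_derivative (?E' - ?c * E s) * exp (- (2 * slope * r * I s))) (at s)"
      unfolding G_def[abs_def]
      by (rule derivative_eq_intros I E refl)+ (simp add: algebra_simps)
    moreover have "?E' \<le> ?c * E s"
      unfolding E_def sum_distrib_left
      by (intro sum_mono lyapunov_term_rate_le) (use r s in auto)
    ultimately show "\<exists>y. (G has_real_derivative y) (at s) \<and> y \<le> 0"
      by (intro exI[of _ "(?E' - ?c * E s) * exp (- (2 * slope * r * I s))"])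
        (auto simp: mult_le_0_iff)
  qed (fact t)
  then have "E t \<le> E 0 * exp (2 * slope * r * I t)"
    by (simp add: G_def I_def exp_minus field_simps)
  then show ?thesis by (simp add: lyap I_def)
qed

end

section \<open>Reduction of the theorem to the platoon\<close>

text \<open>The negative slope makes \<open>v\<close> injective on admissible densities. This
  identifies each \<open>L i\<close> of the platoon with \<open>Lbar\<close>.\<close>

lemma (in velocity_law) equilibrium_gap_unique:
  assumes om: "om > 0" and N: "N > 0" and slope: "slope < 0"
    "\<And>r. r \<in> {0..rho_max om} \<Longrightarrow> deriv_within {0..} (\<lambda>s. v s om) r \<le> slope"
    and eq: "equilibrium_gap N v rho_max vbar om l" "equilibrium_gap N v rho_max vbar om l'"
  shows "l = l'"
proof -
  let ?r = "1 / (real N * l)" and ?r' = "1 / (real N * l')"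
  have pos: "l > 0" "l' > 0" using eq by (auto simp: equilibrium_gap_def)
  have False if "0 \<le> r" "r < r'" "r' \<le> rho_max om" "v r om = v r' om" for r r'
    using v_slope[OF om slope(2), of r r'] mult_neg_pos[OF slope(1), of "r' - r"] that by simp
  from this[of ?r ?r'] this[of ?r' ?r] have "?r = ?r'"
    using eq by (force simp: equilibrium_gap_def)
  then show ?thesis using pos N by simp
qed

theorem theorem3p6:
  fixes eta vbar v'_max om Lbar t :: real
    and w :: "real \<Rightarrow> real"
    and v :: "real \<Rightarrow> real \<Rightarrow> real"
    and rho_max :: "real \<Rightarrow> real"
    and N N_eta J :: nat
    and omega L :: "nat \<Rightarrow> real"
    and x :: "nat \<Rightarrow> real \<Rightarrow> real"
  assumes "N \<ge> 1"
    and "\<And>i. i < N \<Longrightarrow> omega i > 0"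
    and "vbar > 0"
    and "vbar \<le> (MIN i\<in>{..<N}. omega i)"
    and "micro_model eta w v rho_max N N_eta omega vbar x"
    and "\<And>i. i < N \<Longrightarrow> equilibrium_gap N v rho_max vbar (omega i) (L i)"
    and "concave_on {0..eta} w"
    and "v'_max < 0"
    and "\<And>i r. i < N \<Longrightarrow> r \<in> {0..rho_max (omega i)} \<Longrightarrow>
           deriv_within {0..} (\<lambda>s. v s (omega i)) r \<le> v'_max"
    and "\<exists>j<N. (\<Sum>i=j..<N. max (gap x i 0) (L i)) \<le> eta"
    and "J = (LEAST j. j < N \<and> (\<Sum>i=j..<N. max (gap x i 0) (L i)) \<le> eta)"
    and "om > 0"
    and "\<And>i. i \<in> {J..<N} \<Longrightarrow> omega i = om"
    and "equilibrium_gap N v rho_max vbar om Lbar"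
    and "antimono_on {J..<N} (\<lambda>i. gap x i 0) \<and> gap x (N - 1) 0 \<ge> Lbar \<or>
         mono_on {J..<N} (\<lambda>i. gap x i 0) \<and> gap x (N - 1) 0 \<le> Lbar"
    and "t \<ge> 0"
  shows "lyapunov N J x L t \<le>
         lyapunov N J x L 0 *
           exp (2 * v'_max * rho_min N J x L * integral {0..t} (\<lambda>s. w (x N s - x J s)))"
proof -
  interpret micro_model eta w v rho_max N N_eta omega vbar x by fact
  have J: "J < N" "(\<Sum>i=J..<N. max (gap x i 0) (L i)) \<le> eta"
    using LeastI_ex[OF assms(10)] assms(11) by auto
  have marker: "omega i = om" if "i \<in> {J..<N}" for i using assms(13) that .
  have slope: "deriv_within {0..} (\<lambda>s. v s om) r \<le> v'_max" if "r \<in> {0..rho_max om}" for r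
    using assms(9)[of J r] marker[of J] J that by simp
  have L: "L i = Lbar" if "i \<in> {J..<N}" for i
    by (rule equilibrium_gap_unique[OF assms(12) _ assms(8) slope])
      (use assms(6)[of i] marker[OF that] assms(14) that in auto)
  \<comment> \<open>The bound on the last gap spreads to all gaps of the platoon by monotonicity;
    the two alternatives yield the signs 1 and -1.\<close>
  have "\<exists>sg. (sg = 1 \<or> sg = -1) \<and> (\<forall>i\<in>{J..<N}. 0 \<le> sg * (gap x i 0 - Lbar)) \<and>
      (\<forall>i\<ge>J. Suc i < N \<longrightarrow> sg * (gap x (Suc i) 0 - gap x i 0) \<le> 0)"
    using assms(15)
  proof
    assume *: "antimono_on {J..<N} (\<lambda>i. gap x i 0) \<and> gap x (N - 1) 0 \<ge> Lbar"
    then have chain: "gap x k 0 \<le> gap x i 0" if "J \<le> i" "i \<le> k" "k < N" for i k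
      using that by (auto simp: monotone_on_def)
    have "Lbar \<le> gap x i 0" if "i \<in> {J..<N}" for i
    proof -
      have "gap x (N - 1) 0 \<le> gap x i 0" by (rule chain) (use that in auto)
      with conjunct2[OF *] show ?thesis by linarith
    qed
    moreover have "gap x (Suc i) 0 \<le> gap x i 0" if "J \<le> i" "Suc i < N" for i
      by (rule chain) (use that in auto)
    ultimately show ?thesis by (intro exI[of _ 1]) simp
  next
    assume *: "mono_on {J..<N} (\<lambda>i. gap x i 0) \<and> gap x (N - 1) 0 \<le> Lbar"
    then have chain: "gap x i 0 \<le> gap x k 0" if "J \<le> i" "i \<le> k" "k < N" for i k
      using that by (auto simp: monotone_on_def)
    have "gap x i 0 \<le> Lbar" if "i \<in> {J..<N}" for i
    proof -
      have "gap x i 0 \<le> gap x (N - 1) 0" by (rule chain) (use that in auto)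
      with conjunct2[OF *] show ?thesis by linarith
    qed
    moreover have "gap x i 0 \<le> gap x (Suc i) 0" if "J \<le> i" "Suc i < N" for i
      by (rule chain) (use that in auto)
    ultimately show ?thesis by (intro exI[of _ "-1"]) simp
  qed
  then obtain sg where sg: "sg = 1 \<or> sg = -1"
    "\<And>i. i \<in> {J..<N} \<Longrightarrow> 0 \<le> sg * (gap x i 0 - Lbar)"
    "\<And>i. J \<le> i \<Longrightarrow> Suc i < N \<Longrightarrow> sg * (gap x (Suc i) 0 - gap x i 0) \<le> 0"
    by blast
  have length: "(\<Sum>i=J..<N. max (gap x i 0) Lbar) \<le> eta"
    using J(2) L by simp
  interpret platoon eta w v rho_max N N_eta omega vbar x J om Lbar v'_max sg
    by unfold_locales
      (fact J assms(3) assms(7) assms(8) assms(12) assms(14) marker slope sg length)+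
  \<comment> \<open>\<open>rho_min\<close> thus qualifies as the lower bound \<open>r\<close> in
    \<open>lyapunov_decay\<close>.\<close>
  have "rho_min N J x L \<le> min (rho i 0) rho_bar" if "i \<in> {J..<N}" for i
    unfolding rho_min_def by (rule Min_le) (use that L in \<open>auto simp: rho_def rho_bar_def\<close>)
  then have "rho_min N J x L \<le> rho i 0" "rho_min N J x L \<le> rho_bar" if "i \<in> {J..<N}" for i
    using that by simp_all
  then show ?thesis
    using J(1) by (intro lyapunov_decay L assms(16)) auto
qed

end
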